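(* Let $v_i,w_i$ ($i=1,\dots,r$) be the exact solutions of $K(\sigma_i)v_i=B(\sigma_i)b_i$ and $K(\mu_i)^Tw_i=C(\mu_i)^Tc_i$, and let $\widehat v_i,\widehat w_i$ be approximate solutions of these systems computed to relative residual tolerance $\varepsilon>0$, that is, the residuals $\eta_i=K(\sigma_i)\widehat v_i-B(\sigma_i)b_i$ and $\xi_i=K(\mu_i)^T\widehat w_i-C(\mu_i)^Tc_i$ satisfy $\|\eta_i\|\le\varepsilon\|B(\sigma_i)b_i\|$ and $\|\xi_i\|\le\varepsilon\|C(\mu_i)^Tc_i\|$ for all $i$. Let $V_r,\widehat V_r,W_r,\widehat W_r$ be the $n\times r$ matrices with columns $v_i,\widehat v_i,w_i,\widehat w_i$ respectively and let $\mathcal V_r,\widehat{\mathcal V}_r,\mathcal W_r,\widehat{\mathcal W}_r$ be their ranges. Then $$\sin\Theta(\widehat{\mathcal V}_r,\mathcal V_r)\le\frac{\varepsilon\sqrt r}{\varsigma_{\min}(\widehat V_rD_v)},\qquad \sin\Theta(\widehat{\mathcal W}_r,\mathcal W_r)\le\frac{\varepsilon\sqrt r}{\varsigma_{\min}(\widehat W_rD_w)},$$ where $$D_v=\mathrm{diag}\big((\|K(\sigma_1)^{-1}\|\,\|B(\sigma_1)b_1\|)^{-1},\dots,(\|K(\sigma_r)^{-1}\|\,\|B(\sigma_r)b_r\|)^{-1}\big),$$ $$D_w=\mathrm{diag}\big((\|K(\mu_1)^{-1}\|\,\|C(\mu_1)^Tc_1\|)^{-1},\dots,(\|K(\mu_r)^{-1}\|\,\|C(\mu_r)^Tc_r\|)^{-1}\big),$$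 and $\varsigma_{\min}(\cdot)$ denotes the smallest singular value.
   Context: $K(s)\in\mathbb{C}^{n\times n}$, $B(s)\in\mathbb{C}^{n\times m}$, $C(s)\in\mathbb{C}^{p\times n}$ are matrix-valued functions of $s\in\mathbb{C}$; $\sigma_i,\mu_i\in\mathbb{C}$ are interpolation points at which $K$ is nonsingular, and $b_i\in\mathbb{C}^m$, $c_i\in\mathbb{C}^p$ are direction vectors ($i=1,\dots,r$). Standing assumption: each of the sets $\{v_i\}$, $\{w_i\}$, $\{\widehat v_i\}$, $\{\widehat w_i\}$ is linearly independent. $\|\cdot\|$ is the Euclidean vector norm / spectral matrix norm; $^T$ is transpose without conjugation. For subspaces $\mathcal M,\mathcal N$ of $\mathbb{C}^n$, $\Theta(\mathcal M,\mathcal N)\in[0,\pi/2]$ is defined by $\sin\Theta(\mathcal M,\mathcal N)=\sup_{0\ne x\in\mathcal M}\inf_{y\in\mathcal N}\|y-x\|/\|x\|$. *)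

theory Defs
  imports "HOL-Analysis.Analysis"
begin

definition adjoint_matrix :: "complex^'m^'n \<Rightarrow> complex^'n^'m" where
  "adjoint_matrix A = (\<chi> i j. cnj (A $ j $ i))"

definition diag_matrix :: "('r \<Rightarrow> 'a::zero) \<Rightarrow> 'a^'r^'r" where
  "diag_matrix d = (\<chi> i j. if i = j then d i else 0)"

definition matrix_of_columns :: "('r \<Rightarrow> 'a^'n) \<Rightarrow> 'a^'r^'n" where
  "matrix_of_columns v = (\<chi> i j. v j $ i)"

definition matrix_range :: "complex^'r^'n \<Rightarrow> (complex^'n) set" where
  "matrix_range A = range ((*v) A)"

text \<open>Independence as an indexed family (over the complex scalars): repeated vectors are excluded.\<close>

definition lin_indep_family :: "('r \<Rightarrow> complex^'n) \<Rightarrow> bool" where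
  "lin_indep_family v \<longleftrightarrow> inj v \<and> vec.independent (range v)"

definition spectral_norm :: "complex^'m^'n \<Rightarrow> real" where
  "spectral_norm A = onorm ((*v) A)"

text \<open>Singular values by means of left and right singular vectors. For an \<open>n \<times> m\<close> matrix
  this yields exactly the \<open>min n m\<close> diagonal entries of a singular value decomposition;
  in particular 0 is a singular value iff the rank is less than \<open>min n m\<close>, because
  both kernels have to be nontrivial.\<close>

definition is_singular_value :: "complex^'m^'n \<Rightarrow> real \<Rightarrow> bool" where
  "is_singular_value A s \<longleftrightarrow> s \<ge> 0 \<and>
     (\<exists>u v. norm u = 1 \<and> norm v = 1 \<and>
            A *v v = complex_of_real s *s u \<and>
            adjoint_matrix A *v u = complex_of_real s *s v)"

definition smallest_singular_value :: "complex^'m^'n \<Rightarrow> real" where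
  "smallest_singular_value A = (LEAST s. is_singular_value A s)"

text \<open>The angle is meant for complex subspaces with \<open>M \<noteq> {0}\<close>; the supremum over the empty
  set is not specified. It is in general not symmetric in \<open>M\<close> and \<open>N\<close>.\<close>

definition subspace_angle :: "(complex^'n) set \<Rightarrow> (complex^'n) set \<Rightarrow> real" where
  "subspace_angle M N =
     (THE \<theta>. 0 \<le> \<theta> \<and> \<theta> \<le> pi / 2 \<and>
        sin \<theta> = (SUP x\<in>M - {0}. INF y\<in>N. norm (y - x) / norm x))"

end

(* The error v' i - v i is the inverse of K applied to the residual, so D scales every column of
   V' - V to norm at most epsilon. A vector x = V' D z is thus within
   epsilon * sqrt r * norm z of V D z, while norm x is at least the smallest singular value of
   V' D times norm z. *)
theory Submission
  imports Defs
begin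

section \<open>Column matrices, diagonal scaling and independence\<close>

lemma matrix_of_columns_mult:
  "matrix_of_columns v *v x = (\<Sum>j\<in>UNIV. x $ j *s v j)"
  for v :: "'r::finite \<Rightarrow> complex^'n"
  by (simp add: matrix_of_columns_def matrix_vector_mult_def vec_eq_iff mult.commute)

lemma diag_matrix_mult: "diag_matrix d *v x = (\<chi> i. d i * x $ i)"
  for x :: "complex^'r::finite"
  by (simp add: diag_matrix_def matrix_vector_mult_def vec_eq_iff if_distrib if_distribR
      sum.delta cong: if_cong)

lemma matrix_inv:
  assumes "invertible A"
  shows matrix_inv_left: "matrix_inv A ** A = mat 1"
    and matrix_inv_right: "A ** matrix_inv A = mat 1"
  using someI_ex[OF assms[unfolded invertible_def]] by (auto simp: matrix_inv_def)

lemma norm_vector_scalar_mult: "norm (a *s x) = norm a * norm x"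
  for x :: "complex^'n"
  by (simp add: norm_vec_def norm_mult L2_set_right_distrib)

lemma lin_indep_family_nonzero: "lin_indep_family v \<Longrightarrow> v i \<noteq> 0"
  unfolding lin_indep_family_def by (metis rangeI vec.dependent_zero)

text \<open>Injectivity of \<open>v\<close> turns the sum over indices into a sum over the set
  \<open>range v\<close>, to which independence of sets applies.\<close>

lemma lin_indep_family_mult_eq_0:
  fixes v :: "'r::finite \<Rightarrow> complex^'n"
  assumes "lin_indep_family v" "matrix_of_columns v *v x = 0"
  shows "x = 0"
proof -
  have inj: "inj v" and ind: "vec.independent (range v)"
    using assms(1) by (auto simp: lin_indep_family_def)
  have "(\<Sum>y\<in>range v. x $ (inv v y) *s y) = (\<Sum>j\<in>UNIV. x $ j *s v j)"
    by (subst sum.reindex[OF inj]) (simp add: inv_f_f[OF inj])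
  also have "\<dots> = 0"
    using assms(2) by (simp add: matrix_of_columns_mult)
  finally have "x $ (inv v (v j)) = 0" for j
    by (rule vec.independentD[OF ind finite_imageI[OF finite] subset_refl]) auto
  then show ?thesis by (simp add: inv_f_f[OF inj] vec_eq_iff)
qed

section \<open>Spectral norm, adjoint and transpose\<close>

lemma norm_mult_spectral_norm: "norm (A *v x) \<le> spectral_norm A * norm x"
  unfolding spectral_norm_def by (rule onorm[OF matrix_vector_mul_bounded_linear])

lemma spectral_norm_nonneg: "0 \<le> spectral_norm A"
  unfolding spectral_norm_def by (rule onorm_pos_le[OF matrix_vector_mul_bounded_linear])

text \<open>The inner product of \<open>complex^'n\<close> is the real part of the Hermitian one.\<close>

lemma inner_adjoint_matrix: "(A *v x) \<bullet> y = x \<bullet> (adjoint_matrix A *v y)"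
  for A :: "complex^'m^'n"
proof -
  have "(A *v x) \<bullet> y = (\<Sum>i\<in>UNIV. \<Sum>j\<in>UNIV. (A$i$j * x$j) \<bullet> (y$i))"
    by (simp add: inner_vec_def matrix_vector_mult_def inner_sum_left)
  also have "\<dots> = (\<Sum>j\<in>UNIV. \<Sum>i\<in>UNIV. (A$i$j * x$j) \<bullet> (y$i))"
    by (rule sum.swap)
  \<comment> \<open>In the real inner product of complex numbers a factor moves to the other side as
    its conjugate.\<close>
  also have "\<dots> = (\<Sum>j\<in>UNIV. \<Sum>i\<in>UNIV. (x$j) \<bullet> (cnj (A$i$j) * y$i))"
    by (intro sum.cong refl) (simp add: inner_complex_def algebra_simps)
  also have "\<dots> = x \<bullet> (adjoint_matrix A *v y)"
    by (simp add: inner_vec_def matrix_vector_mult_def inner_sum_right adjoint_matrix_def)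
  finally show ?thesis .
qed

text \<open>Pairing the image with itself moves the adjoint back to \<open>A\<close>; after
  Cauchy-Schwarz one factor of its norm cancels.\<close>

lemma norm_adjoint_mult: "norm (adjoint_matrix A *v y) \<le> spectral_norm A * norm y"
proof -
  let ?z = "adjoint_matrix A *v y"
  have "norm ?z * norm ?z = (A *v ?z) \<bullet> y"
    by (simp add: inner_adjoint_matrix power2_norm_eq_inner flip: power2_eq_square)
  also have "\<dots> \<le> norm (A *v ?z) * norm y"
    by (rule norm_cauchy_schwarz)
  also have "\<dots> \<le> (spectral_norm A * norm ?z) * norm y"
    by (intro mult_right_mono norm_mult_spectral_norm) auto
  finally have "norm ?z * norm ?z \<le> norm ?z * (spectral_norm A * norm y)"
    by (simp add: mult_ac)
  then show ?thesis
    by (cases "norm ?z = 0") (auto simp: spectral_norm_nonneg mult_le_cancel_left)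
qed

text \<open>Conjugating all entries turns the transpose into the adjoint and preserves norms. Hence
  the norm of the inverse of \<open>K\<close> itself can serve for the transposed systems.\<close>

lemma norm_transpose_mult: "norm (transpose A *v y) \<le> spectral_norm A * norm y"
  for A :: "complex^'m^'n"
proof -
  have "norm (transpose A *v y) = norm (adjoint_matrix A *v (\<chi> i. cnj (y $ i)))"
  proof -
    have "norm ((transpose A *v y) $ i) = norm ((adjoint_matrix A *v (\<chi> i. cnj (y $ i))) $ i)" for i
      by (simp add: transpose_def adjoint_matrix_def matrix_vector_mult_def
          flip: complex_cnj_mult cnj_sum)
    then show ?thesis by (simp add: norm_vec_def)
  qed
  also have "\<dots> \<le> spectral_norm A * norm (\<chi> i. cnj (y $ i))"
    by (rule norm_adjoint_mult)
  finally show ?thesis by (simp add: norm_vec_def)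
qed

section \<open>Smallest singular value of an injective matrix\<close>

text \<open>The minimum of \<open>norm (A *v z)\<close> over the unit sphere is a singular value by the first-order
  condition for \<open>norm (A *v z)^2 - s^2 * norm z^2\<close>, and no singular value is smaller.\<close>

lemma smallest_singular_value:
  fixes A :: "complex^'m^'n"
  assumes inj: "\<And>z. A *v z = 0 \<Longrightarrow> z = 0"
  shows "0 < smallest_singular_value A"
    and "smallest_singular_value A * norm z \<le> norm (A *v z)"
proof -
  interpret bounded_linear "(*v) A" by (rule matrix_vector_mul_bounded_linear)
  have "continuous_on (sphere 0 1) (\<lambda>z. norm (A *v z))"
    by (intro continuous_intros continuous_on)
  moreover have "sphere (0::complex^'m) 1 \<noteq> {}" by simp
  ultimately obtain z0 where z0: "norm z0 = 1"
    and min: "\<And>z. norm z = 1 \<Longrightarrow> norm (A *v z0) \<le> norm (A *v z)"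
    using continuous_attains_inf[OF compact_sphere] by (metis mem_sphere_0)
  define s where "s = norm (A *v z0)"
  have spos: "0 < s"
    using inj[of z0] z0 by (auto simp: s_def)
  have le: "s * norm z \<le> norm (A *v z)" for z
  proof (cases "z = 0")
    case False
    then have "s \<le> norm (A *v (z /\<^sub>R norm z))"
      unfolding s_def by (intro min) auto
    with False show ?thesis by (simp add: scaleR field_simps)
  qed simp
  \<comment> \<open>\<open>g\<close> is half the real gradient at \<open>z0\<close> of
    \<open>norm (A *v z)^2 - s^2 * norm z^2\<close>, a nonnegative function of \<open>z\<close> that
    vanishes at \<open>z0\<close>.\<close>
  define g where "g = adjoint_matrix A *v (A *v z0) - s\<^sup>2 *\<^sub>R z0"
  have "g = 0"
  proof (rule ccontr)
    assume "g \<noteq> 0"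
    define q where "q = (norm (A *v g))\<^sup>2 - s\<^sup>2 * (norm g)\<^sup>2"
    have q0: "0 \<le> q"
      using power_mono[OF le[of g], of 2] spos by (simp add: q_def power_mult_distrib)
    \<comment> \<open>Along the line through \<open>z0\<close> in direction \<open>g\<close> this
      function is exactly quadratic in \<open>t\<close>, without constant term.\<close>
    have Q: "0 \<le> 2 * t * (g \<bullet> g) + t\<^sup>2 * q" for t :: real
    proof -
      have "0 \<le> (norm (A *v (z0 + t *\<^sub>R g)))\<^sup>2 - s\<^sup>2 * (norm (z0 + t *\<^sub>R g))\<^sup>2"
        using power_mono[OF le[of "z0 + t *\<^sub>R g"], of 2] spos by (simp add: power_mult_distrib)
      also have "\<dots> = (norm (A *v z0))\<^sup>2 - s\<^sup>2 * (norm z0)\<^sup>2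
          + 2 * t * ((A *v g) \<bullet> (A *v z0) - s\<^sup>2 * (g \<bullet> z0)) + t\<^sup>2 * q"
        unfolding q_def add scaleR power2_norm_eq_inner inner_simps
        by (simp add: inner_commute[of z0 g] inner_commute[of "A *v z0" "A *v g"]
            algebra_simps power2_eq_square)
      also have "(A *v g) \<bullet> (A *v z0) - s\<^sup>2 * (g \<bullet> z0) = g \<bullet> g"
        by (subst inner_adjoint_matrix) (simp add: g_def inner_diff_right)
      finally show ?thesis by (simp add: z0 s_def)
    qed
    have gg: "0 < g \<bullet> g" using \<open>g \<noteq> 0\<close> by simp
    \<comment> \<open>A negative step small enough for the linear term to win; \<open>q + 1\<close>
      keeps the denominator positive even for \<open>q = 0\<close>.\<close>
    define t where "t = - (g \<bullet> g) / (q + 1)"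
    have "2 * t * (g \<bullet> g) + t\<^sup>2 * q = (g \<bullet> g)\<^sup>2 * (q / (q + 1) - 2) / (q + 1)"
      using q0 by (simp add: t_def divide_simps power2_eq_square) (simp add: algebra_simps)
    also have "\<dots> < 0"
    proof -
      have "q / (q + 1) \<le> 1" using q0 by (simp add: divide_simps)
      then show ?thesis
        using gg q0 by (intro divide_neg_pos mult_pos_neg zero_less_power) linarith+
    qed
    finally show False using Q[of t] by simp
  qed
  then have AA: "adjoint_matrix A *v (A *v z0) = s\<^sup>2 *\<^sub>R z0" by (simp add: g_def)
  have sc: "complex_of_real a *s x = a *\<^sub>R x" for a and x :: "complex^'k::finite"
    by (simp add: vec_eq_iff scaleR_conv_of_real[where 'a = complex])
  have sv: "is_singular_value A s"
    unfolding is_singular_value_def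
  proof (intro conjI exI)
    \<comment> \<open>The left singular vector is the normalized image of \<open>z0\<close>.\<close>
    show "norm (A *v z0 /\<^sub>R s) = 1" using spos by (simp add: s_def)
    show "A *v z0 = complex_of_real s *s (A *v z0 /\<^sub>R s)" using spos by (simp add: sc)
    have "adjoint_matrix A *v (A *v z0 /\<^sub>R s) = (adjoint_matrix A *v (A *v z0)) /\<^sub>R s"
      by (rule linear_scale[OF matrix_vector_mul_linear])
    then show "adjoint_matrix A *v (A *v z0 /\<^sub>R s) = complex_of_real s *s z0"
      using spos by (simp add: AA sc power2_eq_square)
  qed (use spos z0 in auto)
  \<comment> \<open>A singular value is the norm of \<open>A *v x\<close> for some unit vector
    \<open>x\<close>, hence at least the minimum.\<close>
  have "s \<le> t" if "is_singular_value A t" for t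
  proof -
    from that obtain u x where "t \<ge> 0" "norm u = 1" "norm x = 1" "A *v x = t *\<^sub>R u"
      by (auto simp: is_singular_value_def sc)
    then show ?thesis using le[of x] by simp
  qed
  with sv have "smallest_singular_value A = s"
    unfolding smallest_singular_value_def by (intro Least_equality)
  then show "0 < smallest_singular_value A"
    and "smallest_singular_value A * norm z \<le> norm (A *v z)"
    using spos le by auto
qed

section \<open>Bounding the angle between subspaces\<close>

text \<open>The hypothesis \<open>0 \<in> N\<close> bounds the gap by 1, so that the angle exists.\<close>

lemma sin_subspace_angle_le:
  assumes ne: "x0 \<in> M" "x0 \<noteq> 0" and zero: "0 \<in> N"
    and bound: "\<And>x. x \<in> M \<Longrightarrow> x \<noteq> 0 \<Longrightarrow> \<exists>y\<in>N. norm (y - x) \<le> \<delta> * norm x"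
  shows "sin (subspace_angle M N) \<le> \<delta>"
proof -
  define S where "S = (SUP x\<in>M - {0}. INF y\<in>N. norm (y - x) / norm x)"
  have bdd: "bdd_below ((\<lambda>y. norm (y - x) / norm x) ` N)" for x
    by (rule bdd_belowI[of _ 0]) auto
  have inf_nonneg: "0 \<le> (INF y\<in>N. norm (y - x) / norm x)" for x
    using zero by (intro cINF_greatest) auto
  have inf_le_1: "(INF y\<in>N. norm (y - x) / norm x) \<le> 1" if "x \<in> M - {0}" for x
    using cINF_lower[OF bdd zero, of x] that by simp
  have inf_le: "(INF y\<in>N. norm (y - x) / norm x) \<le> \<delta>" if x: "x \<in> M - {0}" for x
  proof -
    from bound[of x] x obtain y where y: "y \<in> N" "norm (y - x) \<le> \<delta> * norm x" by auto
    have "(INF y\<in>N. norm (y - x) / norm x) \<le> norm (y - x) / norm x"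
      by (rule cINF_lower[OF bdd y(1)])
    also have "\<dots> \<le> \<delta>" using y(2) x by (simp add: divide_simps)
    finally show ?thesis .
  qed
  have "S \<le> 1" "S \<le> \<delta>"
    unfolding S_def using ne inf_le_1 inf_le by (intro cSUP_least; auto)+
  \<comment> \<open>The nonzero vector \<open>x0\<close> makes the supremum run over a nonempty set,
    so it inherits the sign of the infima.\<close>
  have "0 \<le> (INF y\<in>N. norm (y - x0) / norm x0)" by (rule inf_nonneg)
  also have "\<dots> \<le> S"
    unfolding S_def using ne inf_le_1 by (intro cSUP_upper bdd_aboveI[of _ 1]) auto
  finally have "0 \<le> S" .
  \<comment> \<open>Since \<open>S\<close> lies in [0, 1] and sine is injective on [0, pi/2], the
    description in the definition has exactly one solution.\<close>
  have "subspace_angle M N = arcsin S"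
    unfolding subspace_angle_def S_def[symmetric]
  proof (rule the_equality)
    show "0 \<le> arcsin S \<and> arcsin S \<le> pi / 2 \<and> sin (arcsin S) = S"
      using \<open>0 \<le> S\<close> \<open>S \<le> 1\<close> arcsin_le_arcsin[of 0 S] arcsin_ubound[of S] by auto
    show "\<theta> = arcsin S" if "0 \<le> \<theta> \<and> \<theta> \<le> pi / 2 \<and> sin \<theta> = S" for \<theta>
      using that by (auto simp: arcsin_sin)
  qed
  then show ?thesis
    using \<open>0 \<le> S\<close> \<open>S \<le> 1\<close> \<open>S \<le> \<delta>\<close> by simp
qed

section \<open>Perturbation of a column space\<close>

text \<open>Cauchy-Schwarz against the all-ones vector; the source of the factor sqrt r.\<close>

lemma sum_norm_nth_le: "(\<Sum>j\<in>UNIV. norm (z $ j)) \<le> sqrt (real CARD('r)) * norm z"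
  for z :: "complex^'r::finite"
proof -
  have "(\<Sum>j\<in>UNIV. \<bar>1\<bar> * \<bar>norm (z $ j)\<bar>) \<le> L2_set (\<lambda>j::'r. 1) UNIV * L2_set (\<lambda>j. norm (z $ j)) UNIV"
    by (rule L2_set_mult_ineq)
  then show ?thesis by (simp add: norm_vec_def L2_set_def)
qed

text \<open>The perturbation argument, separated from the linear systems: \<open>g i\<close> is the
  scale of the error in column \<open>i\<close>, and \<open>D\<close> divides it out.\<close>

lemma sin_subspace_angle_columns_le:
  fixes v v' :: "'r::finite \<Rightarrow> complex^'n"
  assumes indep: "lin_indep_family v'"
    and g: "\<And>i. 0 < g i" and close: "\<And>i. norm (v' i - v i) \<le> \<epsilon> * g i"
    and D: "D = diag_matrix (\<lambda>i. complex_of_real (inverse (g i)))"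
  shows "sin (subspace_angle (matrix_range (matrix_of_columns v')) (matrix_range (matrix_of_columns v)))
    \<le> \<epsilon> * sqrt (real CARD('r)) / smallest_singular_value (matrix_of_columns v' ** D)"
proof (rule sin_subspace_angle_le)
  define A where "A = matrix_of_columns v' ** D"
  define s where "s = smallest_singular_value A"
  have g0: "g i \<noteq> 0" for i using g[of i] by simp
  have A_mult: "A *v z = matrix_of_columns v' *v (D *v z)" for z
    by (simp add: A_def matrix_vector_mul_assoc)
  have "z = 0" if "A *v z = 0" for z
  proof -
    have "D *v z = 0"
      using that lin_indep_family_mult_eq_0[OF indep] by (simp add: A_mult)
    then show ?thesis using g0 by (simp add: D diag_matrix_mult vec_eq_iff)
  qed
  note s = smallest_singular_value[of A, OF this, folded s_def]
  \<comment> \<open>Index types are nonempty, so \<open>undefined\<close> is a legitimate index, and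
    one column suffices to fix the sign of \<open>\<epsilon>\<close>.\<close>
  have "0 \<le> \<epsilon> * g undefined" using close norm_ge_zero order_trans by blast
  then have eps: "0 \<le> \<epsilon>" using g[of undefined] by (simp add: zero_le_mult_iff)
  show "matrix_of_columns v' *v axis undefined 1 \<in> matrix_range (matrix_of_columns v')"
    by (simp add: matrix_range_def)
  show "matrix_of_columns v' *v axis undefined 1 \<noteq> 0"
    using lin_indep_family_mult_eq_0[OF indep, of "axis undefined 1"] by (auto simp: axis_eq_0_iff)
  show "0 \<in> matrix_range (matrix_of_columns v)"
    unfolding matrix_range_def by (rule range_eqI[of _ _ 0]) simp
  fix x assume "x \<in> matrix_range (matrix_of_columns v')"
  then obtain y where x: "x = matrix_of_columns v' *v y" by (auto simp: matrix_range_def)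
  \<comment> \<open>\<open>z\<close> undoes the scaling, so that \<open>x = A *v z\<close> and the
    singular value bound applies to \<open>z\<close>.\<close>
  define z where "z = (\<chi> i. complex_of_real (g i) * y $ i)"
  have Dz: "D *v z = y" using g0 by (simp add: D diag_matrix_mult z_def vec_eq_iff)
  \<comment> \<open>The competitor for \<open>x\<close> keeps the coefficients \<open>y\<close> and
    replaces the columns \<open>v'\<close> by \<open>v\<close>.\<close>
  have "norm (matrix_of_columns v *v y - x) = norm (\<Sum>j\<in>UNIV. y $ j *s (v j - v' j))"
    by (simp add: x matrix_of_columns_mult vec.scale_right_diff_distrib sum_subtractf)
  also have "\<dots> \<le> (\<Sum>j\<in>UNIV. norm (y $ j *s (v j - v' j)))" by (rule norm_sum)
  also have "\<dots> \<le> (\<Sum>j\<in>UNIV. \<epsilon> * norm (z $ j))"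
  proof (rule sum_mono)
    fix j
    have "norm (y $ j *s (v j - v' j)) = norm (y $ j) * norm (v' j - v j)"
      by (simp only: norm_vector_scalar_mult norm_minus_commute)
    also have "\<dots> \<le> norm (y $ j) * (\<epsilon> * g j)" by (intro mult_left_mono close) auto
    also have "\<dots> = \<epsilon> * norm (z $ j)" using g[of j] by (simp add: z_def norm_mult)
    finally show "norm (y $ j *s (v j - v' j)) \<le> \<epsilon> * norm (z $ j)" .
  qed
  also have "\<dots> \<le> \<epsilon> * (sqrt (real CARD('r)) * norm z)"
    unfolding sum_distrib_left[symmetric] by (intro mult_left_mono sum_norm_nth_le eps)
  also have "\<dots> \<le> \<epsilon> * sqrt (real CARD('r)) * (norm x / s)"
  proof -
    have "norm z \<le> norm x / s"
      using s(1) s(2)[of z] by (simp add: A_mult Dz x field_simps)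
    from mult_left_mono[OF this, of "\<epsilon> * sqrt (real CARD('r))"] eps show ?thesis
      by (simp add: mult_ac)
  qed
  finally show "\<exists>y\<in>matrix_range (matrix_of_columns v). norm (y - x)
      \<le> \<epsilon> * sqrt (real CARD('r)) / smallest_singular_value (matrix_of_columns v' ** D) * norm x"
    by (intro bexI[of _ "matrix_of_columns v *v y"])
      (auto simp: matrix_range_def s_def A_def)
qed

section \<open>From residuals to errors of solutions\<close>

text \<open>\<open>P\<close> plays the role of the inverse of \<open>L\<close>; only \<open>norm (P *v y) \<le> \<kappa> * norm y\<close> is required, so
  that for a transposed system \<open>\<kappa>\<close> can be the norm of the untransposed inverse.\<close>

lemma sin_subspace_angle_solutions_le:
  fixes v v' f :: "'r::finite \<Rightarrow> complex^'n" and L P :: "'r \<Rightarrow> complex^'n^'n"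
  assumes indep: "lin_indep_family v" "lin_indep_family v'"
    and P: "\<And>i. P i ** L i = mat 1" and \<kappa>: "\<And>i y. norm (P i *v y) \<le> \<kappa> i * norm y"
    and v: "\<And>i. L i *v v i = f i"
    and res: "\<And>i. norm (L i *v v' i - f i) \<le> \<epsilon> * norm (f i)"
    and D: "D = diag_matrix (\<lambda>i. complex_of_real (inverse (\<kappa> i * norm (f i))))"
  shows "sin (subspace_angle (matrix_range (matrix_of_columns v')) (matrix_range (matrix_of_columns v)))
    \<le> \<epsilon> * sqrt (real CARD('r)) / smallest_singular_value (matrix_of_columns v' ** D)"
proof (rule sin_subspace_angle_columns_le[OF indep(2) _ _ D])
  fix i
  have PL: "P i *v (L i *v x) = x" for x by (simp add: matrix_vector_mul_assoc P)
  \<comment> \<open>A nonzero exact solution forces \<open>\<kappa> i * norm (f i)\<close> to be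
    positive, so the entries of \<open>D\<close> are genuine reciprocals.\<close>
  have "0 < norm (v i)" using lin_indep_family_nonzero[OF indep(1)] by simp
  also have "\<dots> \<le> \<kappa> i * norm (f i)" using \<kappa>[of i "f i"] PL[of "v i"] by (simp add: v)
  finally show pos: "0 < \<kappa> i * norm (f i)" .
  then have \<kappa>0: "0 \<le> \<kappa> i" by (simp add: zero_less_mult_iff)
  have "v' i - v i = P i *v (L i *v v' i - f i)"
    by (simp add: PL matrix_vector_mult_diff_distrib flip: v)
  also have "norm \<dots> \<le> \<kappa> i * norm (L i *v v' i - f i)" by (rule \<kappa>)
  also have "\<dots> \<le> \<kappa> i * (\<epsilon> * norm (f i))" by (intro mult_left_mono res \<kappa>0)
  finally show "norm (v' i - v i) \<le> \<epsilon> * (\<kappa> i * norm (f i))" by (simp add: mult_ac)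
qed

theorem theorem3p2:
  fixes K :: "complex \<Rightarrow> complex^'n^'n"
    and B :: "complex \<Rightarrow> complex^'m^'n"
    and C :: "complex \<Rightarrow> complex^'n^'p"
    and \<sigma> \<mu> :: "'r::finite \<Rightarrow> complex"
    and b :: "'r \<Rightarrow> complex^'m"
    and c :: "'r \<Rightarrow> complex^'p"
    and v w v' w' \<eta> \<xi> :: "'r \<Rightarrow> complex^'n"
    and \<epsilon> :: real
    and D\<^sub>v D\<^sub>w :: "complex^'r^'r"
  assumes K_\<sigma>: "\<And>i. invertible (K (\<sigma> i))"
    and K_\<mu>: "\<And>i. invertible (K (\<mu> i))"
    and indep: "lin_indep_family v" "lin_indep_family w"
      "lin_indep_family v'" "lin_indep_family w'"
    and eps: "\<epsilon> > 0"
    and v: "\<And>i. K (\<sigma> i) *v v i = B (\<sigma> i) *v b i"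
    and w: "\<And>i. transpose (K (\<mu> i)) *v w i = transpose (C (\<mu> i)) *v c i"
    and \<eta>: "\<And>i. \<eta> i = K (\<sigma> i) *v v' i - B (\<sigma> i) *v b i"
    and \<xi>: "\<And>i. \<xi> i = transpose (K (\<mu> i)) *v w' i - transpose (C (\<mu> i)) *v c i"
    and \<eta>_le: "\<And>i. norm (\<eta> i) \<le> \<epsilon> * norm (B (\<sigma> i) *v b i)"
    and \<xi>_le: "\<And>i. norm (\<xi> i) \<le> \<epsilon> * norm (transpose (C (\<mu> i)) *v c i)"
    and D\<^sub>v: "D\<^sub>v = diag_matrix (\<lambda>i. complex_of_real
      (inverse (spectral_norm (matrix_inv (K (\<sigma> i))) * norm (B (\<sigma> i) *v b i))))"
    and D\<^sub>w: "D\<^sub>w = diag_matrix (\<lambda>i. complex_of_real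
      (inverse (spectral_norm (matrix_inv (K (\<mu> i))) * norm (transpose (C (\<mu> i)) *v c i))))"
  shows "sin (subspace_angle (matrix_range (matrix_of_columns v')) (matrix_range (matrix_of_columns v)))
      \<le> \<epsilon> * sqrt (real CARD('r)) / smallest_singular_value (matrix_of_columns v' ** D\<^sub>v)
    \<and> sin (subspace_angle (matrix_range (matrix_of_columns w')) (matrix_range (matrix_of_columns w)))
      \<le> \<epsilon> * sqrt (real CARD('r)) / smallest_singular_value (matrix_of_columns w' ** D\<^sub>w)"
proof
  show "sin (subspace_angle (matrix_range (matrix_of_columns v')) (matrix_range (matrix_of_columns v)))
      \<le> \<epsilon> * sqrt (real CARD('r)) / smallest_singular_value (matrix_of_columns v' ** D\<^sub>v)"
  proof (rule sin_subspace_angle_solutions_le[OF indep(1,3) _ norm_mult_spectral_norm v _ D\<^sub>v])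
    show "matrix_inv (K (\<sigma> i)) ** K (\<sigma> i) = mat 1" for i
      by (rule matrix_inv_left[OF K_\<sigma>])
    show "norm (K (\<sigma> i) *v v' i - B (\<sigma> i) *v b i) \<le> \<epsilon> * norm (B (\<sigma> i) *v b i)" for i
      using \<eta>_le[of i] by (simp add: \<eta>)
  qed
  show "sin (subspace_angle (matrix_range (matrix_of_columns w')) (matrix_range (matrix_of_columns w)))
      \<le> \<epsilon> * sqrt (real CARD('r)) / smallest_singular_value (matrix_of_columns w' ** D\<^sub>w)"
  proof (rule sin_subspace_angle_solutions_le[OF indep(2,4) _ norm_transpose_mult w _ D\<^sub>w])
    \<comment> \<open>Transposition turns the right inverse of \<open>K (\<mu> i)\<close> into a
      left inverse of its transpose.\<close>
    show "transpose (matrix_inv (K (\<mu> i))) ** transpose (K (\<mu> i)) = mat 1" for i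
      by (simp add: matrix_inv_right[OF K_\<mu>] transpose_mat flip: matrix_transpose_mul)
    show "norm (transpose (K (\<mu> i)) *v w' i - transpose (C (\<mu> i)) *v c i)
        \<le> \<epsilon> * norm (transpose (C (\<mu> i)) *v c i)" for i
      using \<xi>_le[of i] by (simp add: \<xi>)
  qed
qed

end
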